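(* Let $k,d$ be integers with $0<k<d$. Then there is $\varepsilon=\varepsilon(k,d)>0$ such that every $\varepsilon$-net $\mathcal{G}_\varepsilon\subset \mathrm{Gr}(k,d)$ has the following property: there is no polyhedral cone $C\subset\mathbb{R}^d$ such that $U\cap C$ is a $k$-dimensional face of $C$ for every $U\in\mathcal{G}_\varepsilon$.
   Context: $\mathrm{Gr}(k,d)$ is the Grassmannian of $k$-dimensional linear subspaces of $\mathbb{R}^d$. Let $B$ be the Euclidean unit ball centered at the origin. For $U,V\in\mathrm{Gr}(k,d)$, $d(U,V)$ is the Hausdorff distance between $U\cap B$ and $V\cap B$, and the angle between them is $\angle(U,V)=\arcsin(d(U,V))$. An $\varepsilon$-net is a set $\mathcal{G}_\varepsilon\subset\mathrm{Gr}(k,d)$ such that for every $U\in\mathrm{Gr}(k,d)$ there is $V\in\mathcal{G}_\varepsilon$ with $\angle(U,V)<\varepsilon$. A polyhedral cone is an intersection of finitely many closed linear halfspaces. *)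

theory Defs
  imports "HOL-Analysis.Analysis"
begin

text \<open>Hausdorff distance between two (nonempty, bounded) subsets of a metric space.\<close>
definition hausdorff_distance :: "'a::metric_space set \<Rightarrow> 'a set \<Rightarrow> real" where
  "hausdorff_distance A B = max (SUP x\<in>A. infdist x B) (SUP y\<in>B. infdist y A)"

definition grassmannian :: "nat \<Rightarrow> 'a::euclidean_space set set" where
  "grassmannian k = {U. subspace U \<and> dim U = k}"

definition subspace_angle :: "'a::euclidean_space set \<Rightarrow> 'a set \<Rightarrow> real" where
  "subspace_angle U V = arcsin (hausdorff_distance (U \<inter> cball 0 1) (V \<inter> cball 0 1))"

definition eps_net :: "nat \<Rightarrow> real \<Rightarrow> 'a::euclidean_space set set \<Rightarrow> bool" where
  "eps_net k \<epsilon> G \<longleftrightarrow> G \<subseteq> grassmannian k \<and>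
     (\<forall>U\<in>grassmannian k. \<exists>V\<in>G. subspace_angle U V < \<epsilon>)"

definition polyhedral_cone :: "'a::euclidean_space set \<Rightarrow> bool" where
  "polyhedral_cone C \<longleftrightarrow> (\<exists>N. finite N \<and> C = (\<Inter>a\<in>N. {x. a \<bullet> x \<le> 0}))"

end

theory Submission
  imports Defs
begin

text \<open>
  Suppose for \<open>\<epsilon>\<^sub>n \<rightarrow> 0\<close> there are counterexamples \<open>C\<^sub>n\<close>. Pass to a subsequence along which the
  cones \<open>C\<^sub>n\<close> have as many linearly independent limit vectors \<open>b\<^sub>1, \<dots>, b\<^sub>m\<close> as possible
  (\<open>b\<^sub>i\<close> is a limit of vectors of \<open>C\<^sub>n\<close>), and let \<open>S\<close> be their span.

  If \<open>k + m \<le> d\<close>, pick a \<open>k\<close>-dimensional \<open>U\<close> meeting \<open>S\<close> trivially. The subspaces \<open>V\<^sub>n\<close> of the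
  nets that approximate \<open>U\<close> contain unit vectors of \<open>C\<^sub>n\<close>, which accumulate at a unit
  vector of \<open>U\<close>, contradicting the maximality of \<open>m\<close>.

  If \<open>k + m > d\<close>, pick a \<open>k\<close>-dimensional \<open>U\<close> transverse to \<open>S\<close> that contains \<open>b\<^sub>1 + \<dots> + b\<^sub>m\<close>.
  By transversality the approximating \<open>V\<^sub>n\<close> contain a combination with positive coefficients
  of the vectors of \<open>C\<^sub>n\<close> close to \<open>b\<^sub>1, \<dots>, b\<^sub>m\<close>. Since \<open>V\<^sub>n \<inter> C\<^sub>n\<close> is a face, it contains these
  vectors, so in the limit \<open>S \<subseteq> U\<close>, and \<open>U\<close> is the whole space by transversality.
\<close>

subsection \<open>Approximation by subspaces at a small angle\<close>

lemma hausdorff_distance_commute: "hausdorff_distance A B = hausdorff_distance B A"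
  by (simp add: hausdorff_distance_def max.commute)

lemma subspace_angle_commute: "subspace_angle U V = subspace_angle V U"
  by (simp add: subspace_angle_def hausdorff_distance_commute)

lemma infdist_le_hausdorff_distance:
  assumes "bdd_above ((\<lambda>x. infdist x B) ` A)" "x \<in> A"
  shows "infdist x B \<le> hausdorff_distance A B"
  using cSUP_upper[OF assms(2,1)] by (simp add: hausdorff_distance_def max.coboundedI1)

text \<open>The origin lies in \<open>V \<inter> cball 0 1\<close> and is at distance at most 1 from
  \<open>x\<close>. This bound makes the suprema in the Hausdorff distance meaningful and keeps that
  distance in the domain of \<open>arcsin\<close>.\<close>

lemma infdist_subspace_cball_le_1:
  assumes "subspace V" "x \<in> cball 0 1"
  shows "infdist x (V \<inter> cball 0 1) \<le> 1"
proof -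
  have "0 \<in> V \<inter> cball 0 1"
    using assms(1) by (simp add: subspace_0)
  then have "infdist x (V \<inter> cball 0 1) \<le> dist x 0"
    by (rule infdist_le)
  with assms(2) show ?thesis
    by (simp add: dist_commute)
qed

text \<open>The Hausdorff distance \<open>?h\<close> lies in \<open>[0, 1]\<close>, so it is the
  sine of the angle, and sin t \<le> t for t \<ge> 0.\<close>

lemma hausdorff_distance_le_subspace_angle:
  fixes U V :: "'a::euclidean_space set"
  assumes "subspace U" "subspace V"
  shows "hausdorff_distance (U \<inter> cball 0 1) (V \<inter> cball 0 1) \<le> subspace_angle U V"
proof -
  let ?h = "hausdorff_distance (U \<inter> cball 0 1) (V \<inter> cball 0 1)"
  have 0: "0 \<in> U \<inter> cball 0 1" "0 \<in> V \<inter> cball 0 1"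
    using assms by (auto simp: subspace_0)
  have "bdd_above ((\<lambda>x. infdist x (V \<inter> cball 0 1)) ` (U \<inter> cball 0 1))"
    using infdist_subspace_cball_le_1[OF assms(2)] by (intro bdd_aboveI2[where M=1]) auto
  from infdist_le_hausdorff_distance[OF this 0(1)] have ge0: "0 \<le> ?h"
    using 0 by simp
  have "(SUP x\<in>U \<inter> cball 0 1. infdist x (V \<inter> cball 0 1)) \<le> 1"
    using 0 infdist_subspace_cball_le_1[OF assms(2)] by (intro cSUP_least) auto
  moreover have "(SUP x\<in>V \<inter> cball 0 1. infdist x (U \<inter> cball 0 1)) \<le> 1"
    using 0 infdist_subspace_cball_le_1[OF assms(1)] by (intro cSUP_least) auto
  ultimately have le1: "?h \<le> 1"
    by (simp add: hausdorff_distance_def)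
  have "?h = sin (arcsin ?h)"
    using ge0 le1 by simp
  also have "\<dots> \<le> arcsin ?h"
    using ge0 le1 arcsin_le_arcsin[of 0 ?h] by (intro sin_x_le_x) simp
  finally show ?thesis
    by (simp add: subspace_angle_def)
qed

text \<open>Rescaling to a unit vector reduces the claim to the bound on the Hausdorff distance;
  \<open>norm u\<close> is the scaling factor.\<close>

lemma subspace_angle_approx:
  fixes U V :: "'a::euclidean_space set"
  assumes "subspace U" "subspace V" "subspace_angle U V < \<epsilon>" "u \<in> U"
  shows "\<exists>v\<in>V. dist u v \<le> \<epsilon> * norm u"
proof (cases "u = 0")
  case True
  then show ?thesis
    using assms(2) by (intro bexI[of _ 0]) (auto simp: subspace_0)
next
  case False
  define w where "w = u /\<^sub>R norm u"
  have w: "w \<in> U \<inter> cball 0 1"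
    using False assms(1,4) by (simp add: w_def subspace_scale)
  have ne: "V \<inter> cball 0 1 \<noteq> {}"
    using subspace_0[OF assms(2)] by auto
  have "bdd_above ((\<lambda>x. infdist x (V \<inter> cball 0 1)) ` (U \<inter> cball 0 1))"
    using infdist_subspace_cball_le_1[OF assms(2)] by (intro bdd_aboveI2[where M=1]) auto
  from infdist_le_hausdorff_distance[OF this w]
  have "infdist w (V \<inter> cball 0 1) < \<epsilon>"
    using hausdorff_distance_le_subspace_angle[OF assms(1,2)] assms(3) by linarith
  moreover obtain v where v: "v \<in> V \<inter> cball 0 1" "infdist w (V \<inter> cball 0 1) = dist w v"
    using infdist_attains_inf[OF _ ne] closed_subspace[OF assms(2)] by blast
  ultimately have lt: "norm (w - v) < \<epsilon>"
    by (simp add: dist_norm)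
  have "u - norm u *\<^sub>R v = norm u *\<^sub>R (w - v)"
    using False by (simp add: w_def algebra_simps)
  then have "dist u (norm u *\<^sub>R v) = norm u * norm (w - v)"
    by (simp add: dist_norm)
  also have "\<dots> \<le> norm u * \<epsilon>"
    using lt by (intro mult_left_mono) auto
  finally show ?thesis
    using v(1) assms(2) by (intro bexI[of _ "norm u *\<^sub>R v"]) (auto simp: subspace_scale mult.commute)
qed

lemma subspace_angle_tendsto_0_approx:
  fixes U :: "'a::euclidean_space set"
  assumes "subspace U" "\<And>n. subspace (V n)"
    and "\<And>n. subspace_angle U (V n) < \<epsilon> n" "\<epsilon> \<longlonglongrightarrow> 0" "u \<in> U"
  shows "\<exists>v. (\<forall>n. v n \<in> V n) \<and> v \<longlonglongrightarrow> u"
proof -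
  have "\<forall>n. \<exists>v\<in>V n. dist u v \<le> \<epsilon> n * norm u"
    using subspace_angle_approx[OF assms(1,2,3,5)] by blast
  then obtain v where v: "\<And>n. v n \<in> V n" "\<And>n. dist u (v n) \<le> \<epsilon> n * norm u"
    by metis
  have "(\<lambda>n. \<epsilon> n * norm u) \<longlonglongrightarrow> 0"
    using tendsto_mult_left_zero[OF assms(4)] by simp
  then have "(\<lambda>n. dist (v n) u) \<longlonglongrightarrow> 0"
    by (rule Lim_null_comparison[rotated]) (use v(2) in \<open>auto simp: dist_commute\<close>)
  then show ?thesis
    using v(1) by (subst (asm) tendsto_dist_iff[symmetric]) blast
qed

text \<open>Since the angle is symmetric, each \<open>v n\<close> in \<open>V n\<close> is close to
  some \<open>u n\<close> in \<open>U\<close>. The error vanishes because \<open>v\<close> converges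
  and so has bounded norms, and \<open>U\<close> is closed.\<close>

lemma subspace_angle_tendsto_0_limit:
  fixes U :: "'a::euclidean_space set"
  assumes "subspace U" "\<And>n. subspace (V n)"
    and "\<And>n. subspace_angle U (V n) < \<epsilon> n" "\<epsilon> \<longlonglongrightarrow> 0"
    and "eventually (\<lambda>n. v n \<in> V n) sequentially" "v \<longlonglongrightarrow> x"
  shows "x \<in> U"
proof -
  \<comment> \<open>The implication keeps the choice total: where \<open>v n\<close> is outside
    \<open>V n\<close>, the vector \<open>0\<close> serves.\<close>
  have "\<forall>n. \<exists>u\<in>U. v n \<in> V n \<longrightarrow> dist (v n) u \<le> \<epsilon> n * norm (v n)"
    using subspace_angle_approx[OF assms(2,1)] assms(3) subspace_0[OF assms(1)]
    by (metis subspace_angle_commute)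
  then obtain u where u: "\<And>n. u n \<in> U" "\<And>n. v n \<in> V n \<Longrightarrow> dist (v n) (u n) \<le> \<epsilon> n * norm (v n)"
    by metis
  have "(\<lambda>n. \<epsilon> n * norm (v n)) \<longlonglongrightarrow> 0 * norm x"
    by (intro tendsto_intros assms)
  then have "(\<lambda>n. \<epsilon> n * norm (v n)) \<longlonglongrightarrow> 0"
    by simp
  then have "(\<lambda>n. u n - v n) \<longlonglongrightarrow> 0"
    by (rule Lim_null_comparison[rotated])
      (use assms(5) in eventually_elim, use u(2) in \<open>auto simp: dist_norm norm_minus_commute\<close>)
  from tendsto_add[OF this assms(6)] have "u \<longlonglongrightarrow> x"
    by simp
  then show ?thesis
    using closed_subspace[OF assms(1)] u(1) by (metis closed_sequentially)
qed

subsection \<open>Stability of transverse intersections\<close>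

text \<open>The linear maps sending each basis vector \<open>e\<close> to \<open>a n e\<close> tend
  to the identity, so they are eventually invertible with inverses of norm at most 2. The solutions
  therefore tend to 0 along with \<open>q\<close>.\<close>

lemma solve_perturbed_identity:
  fixes a :: "nat \<Rightarrow> 'a::euclidean_space \<Rightarrow> 'a"
  assumes a: "\<And>e. e \<in> Basis \<Longrightarrow> (\<lambda>n. a n e) \<longlonglongrightarrow> e" and q: "q \<longlonglongrightarrow> 0"
  shows "\<exists>y. y \<longlonglongrightarrow> 0 \<and> (\<forall>\<^sub>F n in sequentially. (\<Sum>e\<in>Basis. (y n \<bullet> e) *\<^sub>R a n e) = q n)"
proof -
  define A where "A n y = (\<Sum>e\<in>Basis. (y \<bullet> e) *\<^sub>R a n e)" for n y
  define \<delta> where "\<delta> n = (\<Sum>e\<in>Basis. norm (a n e - e))" for n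
  have lin: "linear (A n)" for n
    unfolding A_def
    by (intro linear_compose_sum ballI linearI) (auto simp: inner_add_left scaleR_add_left)
  have close: "norm (A n y - y) \<le> \<delta> n * norm y" for n y
  proof -
    have "A n y - y = (\<Sum>e\<in>Basis. (y \<bullet> e) *\<^sub>R (a n e - e))"
      unfolding A_def scaleR_diff_right sum_subtractf by (simp add: euclidean_representation)
    also have "norm \<dots> \<le> (\<Sum>e\<in>Basis. norm y * norm (a n e - e))"
      by (intro sum_norm_le) (auto intro!: mult_right_mono Basis_le_norm)
    finally show ?thesis
      by (simp add: \<delta>_def sum_distrib_left mult.commute)
  qed
  have "\<delta> \<longlonglongrightarrow> (\<Sum>e\<in>(Basis::'a set). norm (e - e))"
    unfolding \<delta>_def by (intro tendsto_intros a)
  then have "\<forall>\<^sub>F n in sequentially. \<delta> n < 1/2"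
    by (intro order_tendstoD) auto
  then have solv: "\<forall>\<^sub>F n in sequentially. \<exists>y. A n y = q n \<and> norm y \<le> 2 * norm (q n)"
  proof eventually_elim
    case (elim n)
    have low: "norm y \<le> 2 * norm (A n y)" for y
    \<comment> \<open>As \<open>A n\<close> moves \<open>y\<close> by at most half its norm,
      \<open>A n y\<close> keeps at least half the norm of \<open>y\<close>. Injectivity follows,
      and surjectivity by finite dimension.\<close>
    proof -
      have "norm (A n y - y) \<le> 1/2 * norm y"
        using close[of n y] elim by (meson less_imp_le mult_right_mono norm_ge_zero order_trans)
      moreover have "norm y \<le> norm (A n y) + norm (A n y - y)"
        by (metis norm_minus_commute norm_triangle_sub)
      ultimately show ?thesis by linarith
    qed
    have "inj (A n)"
      unfolding linear_injective_0[OF lin] using low by (metis mult_zero_right norm_le_zero_iff norm_zero)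
    then have "surj (A n)"
      by (rule linear_injective_imp_surjective[OF lin]) simp
    then obtain y where "A n y = q n"
      by (metis surjD)
    then show ?case
      using low by metis
  qed
  define y where "y n = (SOME y. A n y = q n \<and> norm y \<le> 2 * norm (q n))" for n
  have y: "\<forall>\<^sub>F n in sequentially. A n (y n) = q n \<and> norm (y n) \<le> 2 * norm (q n)"
    using solv unfolding y_def by eventually_elim (rule someI_ex)
  have "(\<lambda>n. 2 * norm (q n)) \<longlonglongrightarrow> 0"
    using tendsto_mult_right_zero[OF tendsto_norm_zero[OF q]] .
  then have "y \<longlonglongrightarrow> 0"
    by (rule Lim_null_comparison[rotated]) (use y in eventually_elim, simp)
  with y show ?thesis
    unfolding A_def by (auto elim: eventually_mono)
qed

text \<open>The sum of the \<open>f b n\<close> nearly lies in \<open>V n\<close>. Transversality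
  makes it possible to correct the error by vectors of \<open>V n\<close> and small multiples of the
  \<open>f b n\<close>, so all coefficients stay near 1 and hence positive.\<close>

lemma transverse_positive_combination:
  fixes B U :: "'a::euclidean_space set"
  assumes "finite B" and f: "\<And>b. b \<in> B \<Longrightarrow> f b \<longlonglongrightarrow> b"
    and V: "\<And>n. subspace (V n)"
    and approx: "\<And>u. u \<in> U \<Longrightarrow> \<exists>v. (\<forall>n. v n \<in> V n) \<and> v \<longlonglongrightarrow> u"
    and sumU: "\<Sum>B \<in> U"
    and transverse: "\<And>x. \<exists>s\<in>span B. \<exists>u\<in>U. x = s + u"
  shows "\<forall>\<^sub>F n in sequentially. \<exists>c. (\<forall>b\<in>B. c b > 0) \<and> (\<Sum>b\<in>B. c b *\<^sub>R f b n) \<in> V n"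
proof -
  have "\<forall>x. \<exists>\<alpha> u. u \<in> U \<and> x = (\<Sum>b\<in>B. \<alpha> b *\<^sub>R b) + u"
    using transverse unfolding span_finite[OF \<open>finite B\<close>] by fastforce
  then obtain \<alpha> w where w: "\<And>e. w e \<in> U" and rep: "\<And>e. e = (\<Sum>b\<in>B. \<alpha> e b *\<^sub>R b) + w e"
    by metis
  from w approx have "\<forall>e. \<exists>v. (\<forall>n. v n \<in> V n) \<and> v \<longlonglongrightarrow> w e"
    by blast
  then obtain w' where w': "\<And>e n. w' e n \<in> V n" "\<And>e. w' e \<longlonglongrightarrow> w e"
    by metis
  obtain p where p: "\<And>n. p n \<in> V n" "p \<longlonglongrightarrow> \<Sum>B"
    using approx[OF sumU] by blast
  \<comment> \<open>\<open>a n e\<close> perturbs the decomposition of \<open>e\<close> into its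
    parts in \<open>span B\<close> and \<open>U\<close>; \<open>q n\<close> is the error to be
    corrected.\<close>
  define a where "a n e = (\<Sum>b\<in>B. \<alpha> e b *\<^sub>R f b n) + w' e n" for n e
  define q where "q n = p n - (\<Sum>b\<in>B. f b n)" for n
  have "(\<lambda>n. a n e) \<longlonglongrightarrow> (\<Sum>b\<in>B. \<alpha> e b *\<^sub>R b) + w e" for e
    unfolding a_def by (intro tendsto_intros f w')
  then have a_lim: "(\<lambda>n. a n e) \<longlonglongrightarrow> e" for e
    by (simp only: rep[symmetric])
  have "q \<longlonglongrightarrow> \<Sum>B - \<Sum>B"
    unfolding q_def by (intro tendsto_intros f p)
  then have q_lim: "q \<longlonglongrightarrow> 0"
    by simp
  obtain y where y: "y \<longlonglongrightarrow> 0"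
      "\<forall>\<^sub>F n in sequentially. (\<Sum>e\<in>Basis. (y n \<bullet> e) *\<^sub>R a n e) = q n"
    using solve_perturbed_identity[of a q] a_lim q_lim by blast
  \<comment> \<open>The 1 is the coefficient of \<open>b\<close> in \<open>\<Sum>B\<close>; the rest
    is the correction, which tends to 0 with \<open>y\<close>.\<close>
  define c where "c n b = 1 + (\<Sum>e\<in>Basis. (y n \<bullet> e) * \<alpha> e b)" for n b
  have "(\<lambda>n. c n b) \<longlonglongrightarrow> 1 + (\<Sum>e\<in>Basis. (0 \<bullet> e) * \<alpha> e b)" for b
    unfolding c_def by (intro tendsto_intros y)
  then have "\<forall>\<^sub>F n in sequentially. c n b > 0" for b
    by (intro order_tendstoD) auto
  then have "\<forall>\<^sub>F n in sequentially. \<forall>b\<in>B. c n b > 0"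
    using \<open>finite B\<close> by (simp add: eventually_ball_finite)
  with y(2) show ?thesis
  proof eventually_elim
    case (elim n)
    have "q n = (\<Sum>e\<in>Basis. \<Sum>b\<in>B. ((y n \<bullet> e) * \<alpha> e b) *\<^sub>R f b n) + (\<Sum>e\<in>Basis. (y n \<bullet> e) *\<^sub>R w' e n)"
      unfolding elim(1)[symmetric] a_def
      by (simp add: scaleR_add_right sum.distrib scaleR_sum_right)
    also have "(\<Sum>e\<in>Basis. \<Sum>b\<in>B. ((y n \<bullet> e) * \<alpha> e b) *\<^sub>R f b n)
        = (\<Sum>b\<in>B. (c n b - 1) *\<^sub>R f b n)"
      by (subst sum.swap) (simp add: c_def scaleR_sum_left)
    finally have "(\<Sum>b\<in>B. c n b *\<^sub>R f b n) = p n - (\<Sum>e\<in>Basis. (y n \<bullet> e) *\<^sub>R w' e n)"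
      by (simp add: q_def scaleR_diff_left sum_subtractf algebra_simps)
    also have "\<dots> \<in> V n"
      by (intro subspace_diff subspace_sum subspace_scale V p w')
    finally show ?case
      using elim(2) by blast
  qed
qed

subsection \<open>Cones and their faces\<close>

lemma polyhedral_coneD:
  assumes "polyhedral_cone C"
  shows "0 \<in> C" "\<And>x y. x \<in> C \<Longrightarrow> y \<in> C \<Longrightarrow> x + y \<in> C" "\<And>x t. x \<in> C \<Longrightarrow> 0 \<le> t \<Longrightarrow> t *\<^sub>R x \<in> C"
  using assms unfolding polyhedral_cone_def
  by (auto simp: inner_add_right add_nonpos_nonpos mult_nonneg_nonpos)

lemma polyhedral_cone_sum:
  assumes "polyhedral_cone C" "\<And>b. b \<in> B \<Longrightarrow> g b \<in> C"
  shows "sum g B \<in> C"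
  using assms(2) by (induction B rule: infinite_finite_induct) (auto intro: polyhedral_coneD[OF assms(1)])

text \<open>The point \<open>x + y\<close> is the midpoint of \<open>2 *\<^sub>R x\<close> and
  \<open>2 *\<^sub>R y\<close>, which both lie in the cone, so the face contains these endpoints.
  The case \<open>x = y\<close> is separate because the open segment is then empty.\<close>

lemma face_subspace_summand:
  assumes C: "polyhedral_cone C" and F: "(V \<inter> C) face_of C" and V: "subspace V"
    and xy: "x \<in> C" "y \<in> C" "x + y \<in> V"
  shows "x \<in> V"
proof -
  have "2 *\<^sub>R x \<in> V"
  proof (cases "x = y")
    case True
    with xy show ?thesis
      by (simp add: scaleR_2)
  next
    case False
    then have "x + y \<in> open_segment (2 *\<^sub>R x) (2 *\<^sub>R y)"
      by (auto simp: in_segment intro!: exI[of _ "1/2"])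
    moreover have "2 *\<^sub>R x \<in> C" "2 *\<^sub>R y \<in> C" "x + y \<in> C"
      using xy polyhedral_coneD[OF C] by auto
    ultimately show ?thesis
      using F xy(3) unfolding face_of_def by blast
  qed
  then have "(1/2) *\<^sub>R (2 *\<^sub>R x) \<in> V"
    by (rule subspace_scale[OF V])
  then show ?thesis
    by simp
qed

text \<open>The term of \<open>b\<close> and the sum of the remaining terms both lie in
  \<open>C\<close>, so the two-summand case applies; positivity of \<open>c b\<close> allows
  division.\<close>

lemma face_subspace_positive_combination:
  assumes C: "polyhedral_cone C" and F: "(V \<inter> C) face_of C" and V: "subspace V"
    and B: "finite B" "\<And>b. b \<in> B \<Longrightarrow> g b \<in> C" "\<And>b. b \<in> B \<Longrightarrow> c b > 0"
    and sum: "(\<Sum>b\<in>B. c b *\<^sub>R g b) \<in> V" and b: "b \<in> B"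
  shows "g b \<in> V"
proof -
  have in_C: "c b *\<^sub>R g b \<in> C" if "b \<in> B" for b
    using polyhedral_coneD(3)[OF C] B that by (simp add: less_imp_le)
  have "c b *\<^sub>R g b + (\<Sum>b\<in>B - {b}. c b *\<^sub>R g b) \<in> V"
    using sum by (simp add: sum.remove[OF B(1) b])
  then have "c b *\<^sub>R g b \<in> V"
  proof (rule face_subspace_summand[OF C F V in_C[OF b], rotated])
    show "(\<Sum>b\<in>B - {b}. c b *\<^sub>R g b) \<in> C"
      by (rule polyhedral_cone_sum[OF C]) (simp add: in_C)
  qed
  then have "(1 / c b) *\<^sub>R (c b *\<^sub>R g b) \<in> V"
    by (rule subspace_scale[OF V])
  then show ?thesis
    using B(3)[OF b] by simp
qed

lemma polyhedral_cone_unit_vector: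
  fixes C V :: "'a::euclidean_space set"
  assumes C: "polyhedral_cone C" and V: "subspace V" and "aff_dim (V \<inter> C) > 0"
  shows "\<exists>x. x \<in> V \<inter> C \<and> norm x = 1"
proof -
  have "\<not> V \<inter> C \<subseteq> {0}"
    using assms(3) aff_dim_subset[of "V \<inter> C" "{0}"] by auto
  then obtain x where x: "x \<in> V" "x \<in> C" "x \<noteq> 0"
    by auto
  then have "x /\<^sub>R norm x \<in> V \<inter> C \<and> norm (x /\<^sub>R norm x) = 1"
    using polyhedral_coneD(3)[OF C] V by (auto simp: subspace_scale)
  then show ?thesis
    by blast
qed

subsection \<open>Subspaces in special position\<close>

lemma dim_orthogonal_complement:
  fixes S :: "'a::euclidean_space set"
  assumes "subspace S"
  shows "dim (orthogonal_comp S) + dim S = DIM('a)"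
  using dim_subspace_orthogonal_to_vectors[OF assms subspace_UNIV]
  by (simp add: orthogonal_comp_def orthogonal_commute)

text \<open>The orthogonal complement of \<open>S\<close> has dimension at least \<open>k\<close>,
  and any subspace of it meets \<open>S\<close> trivially.\<close>

lemma ex_subspace_dim_trivial_Int:
  fixes S :: "'a::euclidean_space set"
  assumes "subspace S" "k + dim S \<le> DIM('a)"
  shows "\<exists>U. subspace U \<and> dim U = k \<and> U \<inter> S = {0}"
proof -
  have "k \<le> dim (orthogonal_comp S)"
    using dim_orthogonal_complement[OF assms(1)] assms(2) by simp
  then obtain U where U: "subspace U" "U \<subseteq> span (orthogonal_comp S)" "dim U = k"
    using choose_subspace_of_subspace by blast
  then have "U \<subseteq> orthogonal_comp S"
    by (simp add: subspace_orthogonal_comp span_eq_iff[THEN iffD2])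
  then have "U \<inter> S \<subseteq> {0}"
    using orthogonal_self by (fastforce simp: orthogonal_comp_def)
  then show ?thesis
    using U assms(1) by (auto simp: subspace_0)
qed

lemma ex_superspace_dim:
  fixes W :: "'a::euclidean_space set"
  assumes "dim W \<le> k" "k \<le> DIM('a)"
  shows "\<exists>U. subspace U \<and> dim U = k \<and> W \<subseteq> U"
proof -
  obtain A where A: "A \<subseteq> W" "independent A" "W \<subseteq> span A" "card A = dim W"
    using basis_exists by blast
  obtain E where E: "A \<subseteq> E" "independent E" "UNIV \<subseteq> span E"
    by (rule maximal_independent_subset_extend[OF subset_UNIV A(2)])
  have "card E = DIM('a)"
    using E(2,3) by (metis basis_card_eq_dim dim_UNIV subset_UNIV)
  then obtain D where D: "A \<subseteq> D" "D \<subseteq> E" "card D = k"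
    using exists_subset_between[of A k E] A(4) assms E(1) independent_imp_finite[OF E(2)] by metis
  then have "independent D"
    using E(2) independent_mono by blast
  then have "dim (span D) = k"
    using D(3) by (simp add: dim_span dim_eq_card_independent)
  moreover have "W \<subseteq> span D"
    using A(3) span_mono[OF D(1)] by blast
  ultimately show ?thesis
    using subspace_span by blast
qed

text \<open>Any \<open>U\<close> containing the orthogonal complement of \<open>S\<close> is
  transverse to \<open>S\<close>. The strict inequality leaves one spare dimension for
  \<open>p\<close>.\<close>

lemma ex_transverse_subspace:
  fixes S :: "'a::euclidean_space set"
  assumes S: "subspace S" and k: "DIM('a) < k + dim S" "k \<le> DIM('a)"
  shows "\<exists>U. subspace U \<and> dim U = k \<and> p \<in> U \<and> (\<forall>x. \<exists>s\<in>S. \<exists>u\<in>U. x = s + u)"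
proof -
  let ?O = "orthogonal_comp S"
  have "dim (insert p ?O) \<le> k"
    using dim_orthogonal_complement[OF S] k by (simp add: dim_insert)
  then obtain U where U: "subspace U" "dim U = k" "insert p ?O \<subseteq> U"
    using ex_superspace_dim k(2) by blast
  have "\<exists>s\<in>S. \<exists>u\<in>U. x = s + u" for x
  proof -
    obtain s u where "s \<in> span S" "\<And>w. w \<in> span S \<Longrightarrow> orthogonal u w" "x = s + u"
      using orthogonal_subspace_decomp_exists[of S x] by metis
    moreover from this have "u \<in> ?O"
      by (auto simp: orthogonal_comp_def orthogonal_commute span_base)
    ultimately show ?thesis
      using U(3) S by (metis insert_subset span_eq_iff subsetD)
  qed
  with U show ?thesis
    by blast
qed

section \<open>Contradiction from a maximal family of limit vectors\<close>

theorem theorem2p2: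
  fixes k :: nat
  assumes "0 < k" and "k < DIM('a::euclidean_space)"
  shows "\<exists>\<epsilon>>0. \<forall>G :: 'a set set. eps_net k \<epsilon> G \<longrightarrow>
           \<not> (\<exists>C :: 'a set. polyhedral_cone C \<and>
                 (\<forall>U\<in>G. (U \<inter> C) face_of C \<and> aff_dim (U \<inter> C) = int k))"
proof (rule ccontr)
  define \<epsilon> where "\<epsilon> n = inverse (real (Suc n))" for n
  have \<epsilon>_pos: "\<epsilon> n > 0" for n
    by (simp add: \<epsilon>_def)
  have \<epsilon>_lim: "\<epsilon> \<longlonglongrightarrow> 0"
    unfolding \<epsilon>_def by (rule LIMSEQ_inverse_real_of_nat)
  assume "\<not> ?thesis"
  then have "\<forall>n. \<exists>G :: 'a set set. \<exists>C. eps_net k (\<epsilon> n) G \<and> polyhedral_cone C \<and>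
      (\<forall>U\<in>G. (U \<inter> C) face_of C \<and> aff_dim (U \<inter> C) = int k)"
    using \<epsilon>_pos by blast
  then obtain G :: "nat \<Rightarrow> 'a set set" and C where net: "\<And>n. eps_net k (\<epsilon> n) (G n)"
    and cone: "\<And>n. polyhedral_cone (C n)"
    and face: "\<And>n U. U \<in> G n \<Longrightarrow> (U \<inter> C n) face_of C n \<and> aff_dim (U \<inter> C n) = int k"
    by metis
  \<comment> \<open>The reindexing \<open>r\<close> is arbitrary, so one fixed \<open>U\<close> can
    be approximated along whichever subsequence is selected later.\<close>
  have approx: "\<exists>V. \<forall>n. subspace (V n) \<and> subspace_angle U (V n) < \<epsilon> (r n) \<and>
      (V n \<inter> C (r n)) face_of C (r n) \<and> aff_dim (V n \<inter> C (r n)) = int k"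
    if "subspace U" "dim U = k" for U and r :: "nat \<Rightarrow> nat"
  proof -
    have "\<exists>V\<in>G (r n). subspace V \<and> subspace_angle U V < \<epsilon> (r n)" for n
      using net[of "r n"] that unfolding eps_net_def grassmannian_def by blast
    then show ?thesis
      using face by metis
  qed
  \<comment> \<open>Quantifying over \<open>r\<close> inside \<open>P\<close> makes the maximum
    range over all subsequences, so that passing to a further one cannot exceed it.\<close>
  define P where "P m \<longleftrightarrow> (\<exists>r f B. strict_mono r \<and> independent B \<and> card B = m \<and>
      (\<forall>b\<in>B. (\<forall>n. f b n \<in> C (r n)) \<and> f b \<longlonglongrightarrow> b))" for m
  have "P 0"
    unfolding P_def using strict_mono_id independent_empty by (metis card.empty empty_iff)
  moreover have "\<forall>m. P m \<longrightarrow> m \<le> DIM('a)"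
    unfolding P_def using independent_bound by metis
  ultimately obtain m where "P m" and max: "\<And>m'. P m' \<Longrightarrow> m' \<le> m"
    by (metis GreatestI_nat Greatest_le_nat)
  then obtain r f B where r: "strict_mono (r :: nat \<Rightarrow> nat)" and B: "independent B" "card B = m"
    and f: "\<And>b n. b \<in> B \<Longrightarrow> f b n \<in> C (r n)" "\<And>b. b \<in> B \<Longrightarrow> f b \<longlonglongrightarrow> b"
    unfolding P_def by blast
  have "finite B"
    using B(1) by (rule independent_imp_finite)
  have dimB: "dim (span B) = m"
    using B by (simp add: dim_span dim_eq_card_independent)
  have \<epsilon>r_lim: "(\<lambda>n. \<epsilon> (r n)) \<longlonglongrightarrow> 0"
    using LIMSEQ_subseq_LIMSEQ[OF \<epsilon>_lim r] by (simp add: o_def)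
  show False
  proof (cases "k + m \<le> DIM('a)")
    case True
    then obtain U where U: "subspace U" "dim U = k" "U \<inter> span B = {0}"
      using ex_subspace_dim_trivial_Int[of "span B" k] dimB by auto
    obtain V where V: "\<And>n. subspace (V n)" "\<And>n. subspace_angle U (V n) < \<epsilon> (r n)"
        "\<And>n. aff_dim (V n \<inter> C (r n)) = int k"
      using approx[OF U(1,2), of r] by blast
    have "\<forall>n. \<exists>x. x \<in> V n \<inter> C (r n) \<and> norm x = 1"
      using polyhedral_cone_unit_vector[OF cone V(1)] V(3) assms(1) by simp
    then obtain x where x: "\<And>n. x n \<in> V n" "\<And>n. x n \<in> C (r n)" "\<And>n. norm (x n) = 1"
      by (metis IntD1 IntD2)
    have "\<forall>n. x n \<in> sphere 0 1"
      using x(3) by simp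
    then obtain l s where l: "l \<in> sphere 0 1" and s: "strict_mono (s :: nat \<Rightarrow> nat)" "(x \<circ> s) \<longlonglongrightarrow> l"
      using compact_sphere[of "0::'a" 1] unfolding compact_def by metis
    have "l \<in> U"
    proof (rule subspace_angle_tendsto_0_limit[OF U(1)])
      show "(\<lambda>n. \<epsilon> (r (s n))) \<longlonglongrightarrow> 0"
        using LIMSEQ_subseq_LIMSEQ[OF \<epsilon>r_lim s(1)] by (simp add: o_def)
      show "\<forall>\<^sub>F n in sequentially. (x \<circ> s) n \<in> V (s n)"
        using x(1) by simp
    qed (use V s in \<open>auto simp: o_def\<close>)
    moreover have "l \<noteq> 0"
      using l by auto
    ultimately have "l \<notin> span B"
      using U(3) by blast
    then have ind: "independent (insert l B)" "l \<notin> B"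
      using B(1) independent_insertI span_base by blast+
    have "P (Suc m)"
      unfolding P_def
    proof (intro exI conjI ballI)
      show "strict_mono (r \<circ> s)"
        using r s(1) by (rule strict_mono_o)
      show "card (insert l B) = Suc m"
        using ind(2) \<open>finite B\<close> B(2) by simp
      fix b assume b: "b \<in> insert l B"
      \<comment> \<open>The old sequences are only thinned out along \<open>s\<close>; the new limit
        \<open>l\<close> receives the unit vectors found in the cones.\<close>
      let ?f = "\<lambda>b. if b = l then x \<circ> s else f b \<circ> s"
      show "\<forall>n. ?f b n \<in> C ((r \<circ> s) n)"
        using b x(2) f(1) by auto
      show "?f b \<longlonglongrightarrow> b"
        using b s LIMSEQ_subseq_LIMSEQ[OF f(2) s(1)] by auto
    qed (rule ind)
    then show False
      using max by fastforce
  next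
    case False
    then obtain U where U: "subspace U" "dim U = k" "\<Sum>B \<in> U"
        "\<And>x. \<exists>s\<in>span B. \<exists>u\<in>U. x = s + u"
      using ex_transverse_subspace[of "span B" k "\<Sum>B"] dimB assms(2) by auto
    obtain V where V: "\<And>n. subspace (V n)" "\<And>n. subspace_angle U (V n) < \<epsilon> (r n)"
        "\<And>n. (V n \<inter> C (r n)) face_of C (r n)"
      using approx[OF U(1,2), of r] by blast
    have comb: "\<forall>\<^sub>F n in sequentially. \<exists>c. (\<forall>b\<in>B. c b > 0) \<and> (\<Sum>b\<in>B. c b *\<^sub>R f b n) \<in> V n"
      using subspace_angle_tendsto_0_approx[OF U(1) V(1,2) \<epsilon>r_lim]
      by (intro transverse_positive_combination[OF \<open>finite B\<close> f(2) V(1) _ U(3,4)])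
    have "b \<in> U" if "b \<in> B" for b
    proof (rule subspace_angle_tendsto_0_limit[OF U(1) V(1,2) \<epsilon>r_lim _ f(2)[OF that]])
      show "\<forall>\<^sub>F n in sequentially. f b n \<in> V n"
        using comb
      proof eventually_elim
        case (elim n)
        then obtain c where "\<forall>b\<in>B. c b > 0" "(\<Sum>b\<in>B. c b *\<^sub>R f b n) \<in> V n"
          by blast
        then show ?case
          using face_subspace_positive_combination[OF cone V(3,1) \<open>finite B\<close>, where g = "\<lambda>b. f b n"]
            f(1) that by blast
      qed
    qed
    then have "span B \<subseteq> U"
      using U(1) by (simp add: span_minimal subsetI)
    \<comment> \<open>With \<open>span B\<close> inside \<open>U\<close>, the sum of the two, which
      is the whole space, reduces to \<open>U\<close>.\<close>
    then have "U = UNIV"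
      using U(1,4) by (metis UNIV_eq_I subsetD subspace_add)
    then show False
      using U(2) assms(2) by simp
  qed
qed

end
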